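(* Let $G$ be a graph of order $m$ such that $m\ge\Delta(G)+3$ and $\chi''_a(G)\le\Delta(G)+2$. Then for every integer $n\ge 3$, $$\chi''_a(D_{lex}(P_n,G))\le\Delta(D_{lex}(P_n,G))+2.$$
   Context: All graphs are finite, undirected and simple. $\Delta(G)$ is the maximum degree of $G$, the order of a graph is its number of vertices, and $P_n$ is the path on $n$ vertices. A proper total coloring of $G$ is a coloring of $V(G)\cup E(G)$ in which no two adjacent or incident elements receive the same color. An adjacent vertex distinguishing (AVD) total coloring of $G$ is a proper total coloring $f$ such that $C_G(u)\ne C_G(v)$ for every edge $uv\in E(G)$, where $C_G(u)=\{f(u)\}\cup\{f(uw): uw\in E(G)\}$. The AVD-total chromatic number $\chi''_a(G)$ is the least number of colors in an AVD-total coloring of $G$. The deleted lexicographic product $D_{lex}(G,H)$ has vertex set $V(G)\times V(H)$, with $(g_1,h_1)$ and $(g_2,h_2)$ adjacent if and only if either $g_1g_2\in E(G)$ and $h_1\ne h_2$, or $g_1=g_2$ and $h_1h_2\in E(H)$. *)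

theory Defs
  imports Main
begin

datatype 'a graph = Graph (verts: "'a set") (edges: "'a set set")

definition simple_graph :: "'a graph \<Rightarrow> bool" where
  "simple_graph G \<longleftrightarrow> finite (verts G) \<and> (\<forall>e \<in> edges G. e \<subseteq> verts G \<and> card e = 2)"

definition adj :: "'a graph \<Rightarrow> 'a \<Rightarrow> 'a \<Rightarrow> bool" where
  "adj G u v \<longleftrightarrow> {u, v} \<in> edges G"

definition degree :: "'a graph \<Rightarrow> 'a \<Rightarrow> nat" where
  "degree G v = card {e \<in> edges G. v \<in> e}"

(* The inserted 0 only matters for the graph without vertices, whose maximum degree is 0. *)
definition max_degree :: "'a graph \<Rightarrow> nat" where
  "max_degree G = Max (insert 0 (degree G ` verts G))"

definition path_graph :: "nat \<Rightarrow> nat graph" where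
  "path_graph n = Graph {..<n} {{i, Suc i} | i. Suc i < n}"

definition deleted_lex_product :: "'a graph \<Rightarrow> 'b graph \<Rightarrow> ('a \<times> 'b) graph" where
  "deleted_lex_product G H = Graph (verts G \<times> verts H)
     {{(g1, h1), (g2, h2)} | g1 h1 g2 h2.
        g1 \<in> verts G \<and> g2 \<in> verts G \<and> h1 \<in> verts H \<and> h2 \<in> verts H \<and>
        (adj G g1 g2 \<and> h1 \<noteq> h2 \<or> g1 = g2 \<and> adj H h1 h2)}"

(* A total coloring colors the disjoint union of vertices (Inl) and edges (Inr);
   its values outside of this set are irrelevant. *)
definition proper_total_coloring :: "'a graph \<Rightarrow> ('a + 'a set \<Rightarrow> nat) \<Rightarrow> bool" where
  "proper_total_coloring G f \<longleftrightarrow>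
     (\<forall>u v. adj G u v \<longrightarrow> f (Inl u) \<noteq> f (Inl v)) \<and>
     (\<forall>e \<in> edges G. \<forall>e' \<in> edges G. e \<noteq> e' \<and> e \<inter> e' \<noteq> {} \<longrightarrow> f (Inr e) \<noteq> f (Inr e')) \<and>
     (\<forall>e \<in> edges G. \<forall>v \<in> e. f (Inl v) \<noteq> f (Inr e))"

definition color_set :: "'a graph \<Rightarrow> ('a + 'a set \<Rightarrow> nat) \<Rightarrow> 'a \<Rightarrow> nat set" where
  "color_set G f u = {f (Inl u)} \<union> {f (Inr {u, w}) | w. adj G u w}"

definition avd_total_coloring :: "'a graph \<Rightarrow> ('a + 'a set \<Rightarrow> nat) \<Rightarrow> bool" where
  "avd_total_coloring G f \<longleftrightarrow> proper_total_coloring G f \<and>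
     (\<forall>u v. adj G u v \<longrightarrow> color_set G f u \<noteq> color_set G f v)"

definition avd_total_colorable :: "'a graph \<Rightarrow> nat \<Rightarrow> bool" where
  "avd_total_colorable G k \<longleftrightarrow>
     (\<exists>f. avd_total_coloring G f \<and> f ` (verts G <+> edges G) \<subseteq> {..<k})"

definition avd_total_chromatic_number :: "'a graph \<Rightarrow> nat" where
  "avd_total_chromatic_number G = (LEAST k. avd_total_colorable G k)"

lemma simple_graph_path_graph: "simple_graph (path_graph n)"
  by (auto simp: simple_graph_def path_graph_def)

lemma simple_graph_deleted_lex_product:
  assumes "simple_graph G" "simple_graph H"
  shows "simple_graph (deleted_lex_product G H)"
proof -
  have "g1 \<noteq> g2" if "adj G g1 g2" for g1 g2
    using that assms(1) by (force simp: simple_graph_def adj_def)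
  moreover have "h1 \<noteq> h2" if "adj H h1 h2" for h1 h2
    using that assms(2) by (force simp: simple_graph_def adj_def)
  ultimately show ?thesis
    using assms by (auto simp: simple_graph_def deleted_lex_product_def card_insert_if)
qed

lemma adj_deleted_lex_product:
  assumes "simple_graph G" "simple_graph H"
    and "g1 \<in> verts G" "g2 \<in> verts G" "h1 \<in> verts H" "h2 \<in> verts H"
  shows "adj (deleted_lex_product G H) (g1, h1) (g2, h2) \<longleftrightarrow>
           adj G g1 g2 \<and> h1 \<noteq> h2 \<or> g1 = g2 \<and> adj H h1 h2"
  using assms(3-) unfolding adj_def deleted_lex_product_def
  by (auto simp: doubleton_eq_iff insert_commute)

(* Some coloring always exists (give all elements distinct colors), so the
   minimum above is attained. *)
lemma avd_total_colorable_chromatic_number: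
  assumes "simple_graph G"
  shows "avd_total_colorable G (avd_total_chromatic_number G)"
proof -
  let ?A = "verts G <+> edges G"
  have "edges G \<subseteq> Pow (verts G)"
    using assms by (auto simp: simple_graph_def)
  then have "finite (edges G)"
    using assms by (meson finite_Pow_iff finite_subset simple_graph_def)
  then have "finite ?A"
    using assms by (simp add: simple_graph_def)
  then obtain f where f: "bij_betw f ?A {0..<card ?A}"
    using ex_bij_betw_finite_nat by blast
  then have inj: "f x = f y \<longleftrightarrow> x = y" if "x \<in> ?A" "y \<in> ?A" for x y
    using that by (meson bij_betw_imp_inj_on inj_on_eq_iff)
  have vert: "v \<in> verts G" if "e \<in> edges G" "v \<in> e" for e v
    using that assms by (auto simp: simple_graph_def)
  have neq: "u \<noteq> v" if "adj G u v" for u v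
    using that assms by (force simp: simple_graph_def adj_def)
  have ends: "u \<in> verts G" "v \<in> verts G" if "adj G u v" for u v
    using that vert by (auto simp: adj_def)
  have "proper_total_coloring G f"
    using inj vert neq ends by (auto simp: proper_total_coloring_def InlI InrI)
  moreover have "color_set G f u \<noteq> color_set G f v" if "adj G u v" for u v
  proof -
    have "f (Inl u) \<notin> color_set G f v"
      using inj neq[OF that] ends[OF that] by (auto simp: color_set_def adj_def InlI InrI)
    then show ?thesis
      by (auto simp: color_set_def)
  qed
  moreover have "f ` ?A \<subseteq> {..<card ?A}"
    using f by (simp add: bij_betw_def atLeast0LessThan)
  ultimately have "avd_total_colorable G (card ?A)"
    unfolding avd_total_colorable_def avd_total_coloring_def by blast
  then show ?thesis
    unfolding avd_total_chromatic_number_def by (rule LeastI)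
qed

end

theory Submission imports Defs begin

text \<open>
  Let \<open>k = \<Delta>(G) + 2\<close> and \<open>l = m - 1 - k \<ge> 0\<close>. The \<open>\<Delta>(D\<^bsub>lex\<^esub>(P\<^sub>n, G)) + 2 = 3k + 2l\<close> available
  colors are split into blocks \<open>X\<^sub>0, X\<^sub>1, X\<^sub>2\<close> of size \<open>k\<close> and \<open>E\<^sub>0, E\<^sub>1\<close> of size \<open>l\<close>. The \<open>i\<close>-th copy of \<open>G\<close> is
  colored by the given coloring with palette \<open>X\<^bsub>i mod 3\<^esub>\<close>. The edges between the copies \<open>i\<close> and
  \<open>i + 1\<close> form \<open>K\<^bsub>m,m\<^esub>\<close> minus a perfect matching, and are colored by cyclic differences with the
  \<open>m - 1\<close> colors of \<open>X\<^bsub>(i + 2) mod 3\<^esub> \<union> E\<^bsub>i mod 2\<^esub>\<close>; each end of such an edge sees this whole palette.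
  The palettes meeting at a vertex are disjoint, and so are the palettes of consecutive copies.
  A vertex never sees all of its own block, since it has at most \<open>\<Delta>(G) + 1 < k\<close> colors there, but
  a vertex with neighbors in two other copies sees all of the other two blocks. As \<open>n \<ge> 3\<close>, one of
  any two adjacent vertices in consecutive copies is of this kind.
\<close>

section \<open>Color blocks and cyclic differences\<close>

definition copy_color :: "nat \<Rightarrow> nat \<Rightarrow> nat \<Rightarrow> nat" where
  "copy_color k i c = k * (i mod 3) + c"

text \<open>Modulo 3, \<open>i + 2\<close> differs from \<open>i\<close> and \<open>i + 1\<close>,
  so the first \<open>k\<close> colors fill the block that neither adjoining copy uses for itself.
  The others go to one of two blocks of length \<open>l\<close> starting at \<open>3 * k\<close>,
  chosen by parity.\<close>

definition gap_color :: "nat \<Rightarrow> nat \<Rightarrow> nat \<Rightarrow> nat \<Rightarrow> nat" where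
  "gap_color k l i c =
     (if c < k then copy_color k (i + 2) c else 3 * k + l * (i mod 2) + (c - k))"

text \<open>This is \<open>y - x - 1\<close> modulo \<open>m\<close> for \<open>x, y < m\<close>,
  written without subtracting below zero. The shift by 1 moves the nonzero differences to the range
  from \<open>0\<close> to \<open>m - 2\<close>.\<close>

definition cyclic_diff :: "nat \<Rightarrow> nat \<Rightarrow> nat \<Rightarrow> nat" where
  "cyclic_diff m x y = (if x < y then y - x - 1 else y + m - x - 1)"

lemma copy_color_eq_iff:
  assumes "c < k" "c' < k"
  shows "copy_color k i c = copy_color k j c' \<longleftrightarrow> i mod 3 = j mod 3 \<and> c = c'"
proof -
  have "(k * p + c) div k = p" "(k * p + c') div k = p" for p
    using assms by auto
  then show ?thesis
    unfolding copy_color_def by (metis add_left_cancel)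
qed

lemma copy_color_less:
  assumes "c < k"
  shows "copy_color k i c < 3 * k"
proof -
  have "i mod 3 = 0 \<or> i mod 3 = 1 \<or> i mod 3 = 2"
    by presburger
  then show ?thesis
    using assms by (auto simp: copy_color_def)
qed

lemma mod_3_neq: "i mod 3 \<noteq> Suc i mod 3" "i mod 3 \<noteq> Suc (Suc i) mod 3"
  for i :: nat
  by presburger+

lemma gap_color_less:
  assumes "c < k + l"
  shows "gap_color k l i c < 3 * k + 2 * l"
proof -
  have "i mod 2 = 0 \<or> i mod 2 = 1"
    by presburger
  then show ?thesis
    using assms copy_color_less[of c k "i + 2"] by (auto simp: gap_color_def)
qed

lemma gap_color_inject:
  assumes "gap_color k l i c = gap_color k l i c'"
  shows "c = c'"
  using assms copy_color_less[of c k "i + 2"] copy_color_less[of c' k "i + 2"]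
  by (auto simp: gap_color_def copy_color_eq_iff split: if_splits)

lemma copy_color_neq_gap_color:
  assumes "c < k"
  shows "copy_color k i c \<noteq> gap_color k l i d"
    and "copy_color k (Suc i) c \<noteq> gap_color k l i d"
  using assms copy_color_less[of c k i] copy_color_less[of c k "Suc i"] mod_3_neq[of i]
    mod_3_neq[of "Suc i"]
  by (auto simp: gap_color_def copy_color_eq_iff)

text \<open>Consecutive gaps meet at a common copy. Their blocks of size \<open>k\<close> differ
  modulo 3 and their extra blocks differ in parity; the bounds keep the first extra block from
  running into the second.\<close>

lemma gap_color_neq_Suc:
  assumes "c < k + l" "d < k + l"
  shows "gap_color k l i c \<noteq> gap_color k l (Suc i) d"
proof -
  have "i mod 2 = 0 \<and> Suc i mod 2 = 1 \<or> i mod 2 = 1 \<and> Suc i mod 2 = 0"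
    by presburger
  then show ?thesis
    using assms copy_color_less[of c k "i + 2"] copy_color_less[of d k "Suc i + 2"]
      mod_3_neq[of "i + 2"]
    by (auto simp: gap_color_def copy_color_eq_iff)
qed

text \<open>Since \<open>Suc i + 2\<close> is \<open>i\<close> modulo 3, the gap above copy
  \<open>i + 1\<close> shows the block of copy \<open>i\<close>. This is what separates vertices of
  consecutive copies.\<close>

lemma gap_color_Suc_eq_copy_color: "c < k \<Longrightarrow> gap_color k l (Suc i) c = copy_color k i c"
  by (simp add: gap_color_def copy_color_def)

lemma cyclic_diff_less: "\<lbrakk>x < m; y < m; x \<noteq> y\<rbrakk> \<Longrightarrow> cyclic_diff m x y < m - 1"
  by (auto simp: cyclic_diff_def)

lemma cyclic_diff_inject_right:
  "\<lbrakk>x < m; y < m; y' < m; x \<noteq> y; x \<noteq> y'; cyclic_diff m x y = cyclic_diff m x y'\<rbrakk> \<Longrightarrow> y = y'"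
  by (auto simp: cyclic_diff_def split: if_splits)

lemma cyclic_diff_inject_left:
  "\<lbrakk>x < m; x' < m; y < m; x \<noteq> y; x' \<noteq> y; cyclic_diff m x y = cyclic_diff m x' y\<rbrakk> \<Longrightarrow> x = x'"
  by (auto simp: cyclic_diff_def split: if_splits)

lemma cyclic_diff_surj_right:
  assumes "x < m" "d < m - 1"
  shows "\<exists>y < m. x \<noteq> y \<and> cyclic_diff m x y = d"
  using assms
  \<comment> \<open>The witness is \<open>x + d + 1\<close> reduced modulo \<open>m\<close>.\<close>
  by (intro exI[of _ "if x + d + 1 < m then x + d + 1 else x + d + 1 - m"])
    (auto simp: cyclic_diff_def)

lemma cyclic_diff_surj_left:
  assumes "y < m" "d < m - 1"
  shows "\<exists>x < m. x \<noteq> y \<and> cyclic_diff m x y = d"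
  using assms
  \<comment> \<open>The witness is \<open>y - d - 1\<close> reduced modulo \<open>m\<close>.\<close>
  by (intro exI[of _ "if d + 1 \<le> y then y - d - 1 else y + m - d - 1"])
    (auto simp: cyclic_diff_def)

section \<open>Simple graphs and total colorings\<close>

lemma simple_graph_adjD:
  assumes "simple_graph G" "adj G u v"
  shows "u \<in> verts G" "v \<in> verts G" "u \<noteq> v"
  using assms by (force simp: simple_graph_def adj_def)+

lemma simple_graph_edgeE:
  assumes "simple_graph G" "e \<in> edges G" "u \<in> e"
  obtains v where "e = {u, v}" "adj G u v"
proof -
  have "card e = 2"
    using assms by (simp add: simple_graph_def)
  then obtain v where "e = {u, v}"
    using assms(3) by (auto simp: card_2_iff)
  with assms(2) that show ?thesis
    by (auto simp: adj_def)
qed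

lemma degree_eq_card_neighbors:
  assumes "simple_graph G"
  shows "degree G v = card {w. adj G v w}"
proof -
  have "{e \<in> edges G. v \<in> e} = (\<lambda>w. {v, w}) ` {w. adj G v w}"
  proof (intro equalityI subsetI)
    fix e assume "e \<in> {e \<in> edges G. v \<in> e}"
    then obtain w where "e = {v, w}" "adj G v w"
      using simple_graph_edgeE[OF assms] by blast
    then show "e \<in> (\<lambda>w. {v, w}) ` {w. adj G v w}"
      by blast
  qed (auto simp: adj_def)
  moreover have "inj_on (\<lambda>w. {v, w}) {w. adj G v w}"
    by (auto simp: inj_on_def doubleton_eq_iff)
  ultimately show ?thesis
    by (simp add: degree_def card_image)
qed

lemma finite_neighbors:
  assumes "simple_graph G"
  shows "finite {w. adj G v w}"
proof (rule finite_subset)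
  show "{w. adj G v w} \<subseteq> verts G"
    using simple_graph_adjD[OF assms] by auto
qed (use assms in \<open>simp add: simple_graph_def\<close>)

lemma degree_le_max_degree:
  assumes "simple_graph G" "v \<in> verts G"
  shows "degree G v \<le> max_degree G"
  using assms by (auto simp: max_degree_def simple_graph_def)

lemma max_degree_attained:
  assumes "simple_graph G" "verts G \<noteq> {}"
  obtains v where "v \<in> verts G" "degree G v = max_degree G"
proof -
  have "max_degree G \<in> insert 0 (degree G ` verts G)"
    unfolding max_degree_def using assms by (intro Max_in) (auto simp: simple_graph_def)
  \<comment> \<open>If the maximum is the inserted 0, every vertex has degree 0, so any vertex
    attains it.\<close>
  moreover have "\<exists>v \<in> verts G. degree G v = max_degree G" if "max_degree G = 0"
    using assms that degree_le_max_degree by fastforce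
  ultimately show ?thesis
    using that by auto
qed

text \<open>Two edges that meet have the form \<open>{u, v}\<close> and \<open>{u, w}\<close>, so
  properness can be checked vertex by vertex.\<close>

lemma proper_total_coloringI:
  assumes "simple_graph G"
    and "\<And>u v. adj G u v \<Longrightarrow> f (Inl u) \<noteq> f (Inl v)"
    and "\<And>u v w. \<lbrakk>adj G u v; adj G u w; v \<noteq> w\<rbrakk> \<Longrightarrow> f (Inr {u, v}) \<noteq> f (Inr {u, w})"
    and "\<And>u v. adj G u v \<Longrightarrow> f (Inl u) \<noteq> f (Inr {u, v})"
  shows "proper_total_coloring G f"
  unfolding proper_total_coloring_def
proof (intro conjI allI ballI impI)
  fix e e' assume e: "e \<in> edges G" "e' \<in> edges G" "e \<noteq> e' \<and> e \<inter> e' \<noteq> {}"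
  then obtain u where "u \<in> e" "u \<in> e'"
    by auto
  with e assms(1) obtain v w where "e = {u, v}" "adj G u v" "e' = {u, w}" "adj G u w"
    by (metis simple_graph_edgeE)
  with e assms(3) show "f (Inr e) \<noteq> f (Inr e')"
    by blast
next
  fix e v assume "e \<in> edges G" "v \<in> e"
  with assms(1,4) show "f (Inl v) \<noteq> f (Inr e)"
    by (metis simple_graph_edgeE)
qed (use assms(2) in auto)

lemma proper_total_coloringD:
  assumes "simple_graph G" "proper_total_coloring G f" "adj G u v"
  shows "f (Inl u) \<noteq> f (Inl v)" "f (Inl u) \<noteq> f (Inr {u, v})"
    and "\<lbrakk>adj G u w; v \<noteq> w\<rbrakk> \<Longrightarrow> f (Inr {u, v}) \<noteq> f (Inr {u, w})"
  using assms by (auto simp: proper_total_coloring_def adj_def doubleton_eq_iff)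

text \<open>A vertex and its incident edges carry at most \<open>max_degree G + 1\<close> colors,
  whatever the coloring.\<close>

lemma color_set_misses:
  assumes "simple_graph G" "v \<in> verts G"
  shows "\<exists>c < max_degree G + 2. c \<notin> color_set G f v"
proof (rule ccontr)
  assume "\<not> ?thesis"
  then have sub: "{..<max_degree G + 2} \<subseteq> color_set G f v"
    by auto
  have eq: "color_set G f v = insert (f (Inl v)) ((\<lambda>w. f (Inr {v, w})) ` {w. adj G v w})"
    by (auto simp: color_set_def)
  have "card (color_set G f v) \<le> Suc (card ((\<lambda>w. f (Inr {v, w})) ` {w. adj G v w}))"
    unfolding eq by (rule card_insert_le_m1) auto
  also have "\<dots> \<le> Suc (degree G v)"
    using card_image_le[OF finite_neighbors[OF assms(1)]]
    by (simp add: degree_eq_card_neighbors[OF assms(1)])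
  also have "\<dots> \<le> max_degree G + 1"
    using degree_le_max_degree[OF assms] by simp
  finally show False
    using card_mono[OF _ sub] finite_neighbors[OF assms(1), of v] by (simp add: eq)
qed

lemma avd_total_colorable_max_degree_add_2:
  assumes "simple_graph G" "avd_total_chromatic_number G \<le> max_degree G + 2"
  shows "avd_total_colorable G (max_degree G + 2)"
  using avd_total_colorable_chromatic_number[OF assms(1)] assms(2)
  unfolding avd_total_colorable_def by (meson lessThan_subset_iff order_trans)

section \<open>Adjacency and maximum degree in the product with a path\<close>

lemma adj_path_product:
  assumes "simple_graph G"
  shows "adj (deleted_lex_product (path_graph n) G) (i, a) (j, b) \<longleftrightarrow>
     i < n \<and> j < n \<and> a \<in> verts G \<and> b \<in> verts G \<and>
     (i = j \<and> adj G a b \<or> (j = Suc i \<or> i = Suc j) \<and> a \<noteq> b)"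
proof (cases "i < n \<and> j < n \<and> a \<in> verts G \<and> b \<in> verts G")
  case True
  then have "adj (path_graph n) i j \<longleftrightarrow> j = Suc i \<or> i = Suc j"
    by (auto simp: adj_def path_graph_def doubleton_eq_iff)
  with True show ?thesis
    using adj_deleted_lex_product[OF simple_graph_path_graph assms, of i n j a b]
    by (auto simp: path_graph_def)
next
  case False
  then show ?thesis
    using simple_graph_adjD(1,2)[OF
        simple_graph_deleted_lex_product[OF simple_graph_path_graph assms], of n "(i, a)" "(j, b)"]
    by (auto simp: deleted_lex_product_def path_graph_def)
qed

text \<open>For \<open>n \<ge> 3\<close>, copy 1 lies between two others: a vertex of maximum degree
  in it keeps its neighbors in the copy and gains all but one vertex of each of the copies 0 and
  2.\<close>

lemma max_degree_path_product_ge: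
  assumes G: "simple_graph G" "verts G \<noteq> {}" and n: "n \<ge> 3"
  shows "max_degree G + 2 * (card (verts G) - 1)
         \<le> max_degree (deleted_lex_product (path_graph n) G)"
proof -
  let ?P = "deleted_lex_product (path_graph n) G"
  have P: "simple_graph ?P"
    by (simp add: G simple_graph_deleted_lex_product simple_graph_path_graph)
  obtain v where v: "v \<in> verts G" "degree G v = max_degree G"
    using max_degree_attained[OF G] .
  have fin: "finite (verts G)"
    using G by (simp add: simple_graph_def)
  let ?N = "{w. adj G v w}" and ?V = "verts G - {v}"
  have neighbors: "{w. adj ?P (1, v) w} = {1} \<times> ?N \<union> {0, 2} \<times> ?V"
    using n v simple_graph_adjD[OF G(1)] by (auto simp: adj_path_product[OF G(1)])
  have "degree ?P (1, v) = card ({1 :: nat} \<times> ?N) + card ({0, 2 :: nat} \<times> ?V)"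
    unfolding degree_eq_card_neighbors[OF P] neighbors
    using fin finite_neighbors[OF G(1)] by (intro card_Un_disjoint) auto
  also have "\<dots> = max_degree G + 2 * (card (verts G) - 1)"
    using v fin by (simp add: card_cartesian_product degree_eq_card_neighbors[OF G(1)])
  finally show ?thesis
    using degree_le_max_degree[OF P, of "(1, v)"] v n
    by (simp add: deleted_lex_product_def path_graph_def)
qed

section \<open>The coloring of the product\<close>

text \<open>
  An edge inside a copy is recognized by having a single layer; otherwise its lower layer is the
  minimum. The argument \<open>r\<close> numbers the vertices of the factor.
\<close>

definition layer_coloring ::
  "('a \<Rightarrow> nat) \<Rightarrow> nat \<Rightarrow> nat \<Rightarrow> ('a + 'a set \<Rightarrow> nat) \<Rightarrow> (nat \<times> 'a) + (nat \<times> 'a) set \<Rightarrow> nat" where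
  "layer_coloring r k l f x = (case x of
     Inl v \<Rightarrow> copy_color k (fst v) (f (Inl (snd v)))
   | Inr e \<Rightarrow> let i = Min (fst ` e) in
       if fst ` e = {i} then copy_color k i (f (Inr (snd ` e)))
       else gap_color k l i
         (cyclic_diff (Suc (k + l)) (r (THE a. (i, a) \<in> e)) (r (THE b. (Suc i, b) \<in> e))))"

text \<open>An edge between copies appears in both orders, so that its color can be rewritten from
  either end.\<close>

lemma layer_coloring_simps:
  "layer_coloring r k l f (Inl (i, a)) = copy_color k i (f (Inl a))"
  "layer_coloring r k l f (Inr {(i, a), (i, b)}) = copy_color k i (f (Inr {a, b}))"
  "layer_coloring r k l f (Inr {(i, a), (Suc i, b)}) =
     gap_color k l i (cyclic_diff (Suc (k + l)) (r a) (r b))"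
  "layer_coloring r k l f (Inr {(Suc i, b), (i, a)}) =
     gap_color k l i (cyclic_diff (Suc (k + l)) (r a) (r b))"
  by (auto simp: layer_coloring_def Let_def min_def)

text \<open>The order of \<open>G\<close> enters as \<open>Suc (k + l)\<close> through the range of
  \<open>r\<close>, which avoids subtraction.\<close>

locale layered =
  fixes G :: "'a graph" and r :: "'a \<Rightarrow> nat" and k l n :: nat and f :: "'a + 'a set \<Rightarrow> nat"
  assumes simple: "simple_graph G"
    and r: "bij_betw r (verts G) {..<Suc (k + l)}"
    and k: "k = max_degree G + 2"
    and avd: "avd_total_coloring G f"
    and f_range: "f ` (verts G <+> edges G) \<subseteq> {..<k}"
    and n: "n \<ge> 3"
begin

abbreviation "P \<equiv> deleted_lex_product (path_graph n) G"
abbreviation "F \<equiv> layer_coloring r k l f"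
abbreviation "d a b \<equiv> cyclic_diff (Suc (k + l)) (r a) (r b)"

lemma simple_P: "simple_graph P"
  by (simp add: simple simple_graph_deleted_lex_product simple_graph_path_graph)

lemmas adj_P = adj_path_product[OF simple]

lemma proper: "proper_total_coloring G f"
  using avd by (simp add: avd_total_coloring_def)

lemma f_vertex_less: "a \<in> verts G \<Longrightarrow> f (Inl a) < k"
  using f_range by blast

lemma f_edge_less: "adj G a b \<Longrightarrow> f (Inr {a, b}) < k"
  using f_range by (auto simp: adj_def)

lemma r_less: "a \<in> verts G \<Longrightarrow> r a < Suc (k + l)"
  using r by (auto simp: bij_betw_def)

lemma r_eq_iff: "\<lbrakk>a \<in> verts G; b \<in> verts G\<rbrakk> \<Longrightarrow> r a = r b \<longleftrightarrow> a = b"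
  using r by (auto simp: bij_betw_def inj_on_eq_iff)

lemma d_less: "\<lbrakk>a \<in> verts G; b \<in> verts G; a \<noteq> b\<rbrakk> \<Longrightarrow> d a b < k + l"
  using cyclic_diff_less[of "r a" "Suc (k + l)" "r b"] r_less r_eq_iff by simp

lemma d_inject_right:
  "\<lbrakk>a \<in> verts G; b \<in> verts G; c \<in> verts G; a \<noteq> b; a \<noteq> c; d a b = d a c\<rbrakk> \<Longrightarrow> b = c"
  using cyclic_diff_inject_right[of "r a" "Suc (k + l)" "r b" "r c"] r_less r_eq_iff by metis

lemma d_inject_left:
  "\<lbrakk>a \<in> verts G; b \<in> verts G; c \<in> verts G; a \<noteq> c; b \<noteq> c; d a c = d b c\<rbrakk> \<Longrightarrow> a = b"
  using cyclic_diff_inject_left[of "r a" "Suc (k + l)" "r b" "r c"] r_less r_eq_iff by metis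

lemma r_surj: "x < Suc (k + l) \<Longrightarrow> \<exists>a \<in> verts G. r a = x"
  using bij_betw_imp_surj_on[OF r] by (metis imageE lessThan_iff)

lemma d_surj_right: "\<lbrakk>a \<in> verts G; c < k + l\<rbrakk> \<Longrightarrow> \<exists>b \<in> verts G. a \<noteq> b \<and> d a b = c"
  using cyclic_diff_surj_right[of "r a" "Suc (k + l)" c] r_less r_surj
  by (metis diff_Suc_1)

lemma d_surj_left: "\<lbrakk>b \<in> verts G; c < k + l\<rbrakk> \<Longrightarrow> \<exists>a \<in> verts G. a \<noteq> b \<and> d a b = c"
  using cyclic_diff_surj_left[of "r b" "Suc (k + l)" c] r_less r_surj
  by (metis diff_Suc_1)

text \<open>Differences are always taken from the lower copy to the upper one, hence the exchanged
  arguments of \<open>d\<close> in the case \<open>down\<close>.\<close>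

lemma adj_P_cases:
  assumes "adj P (i, a) y"
  obtains
    (copy) b where "y = (i, b)" "adj G a b" "F (Inr {(i, a), y}) = copy_color k i (f (Inr {a, b}))"
  | (up) b where "y = (Suc i, b)" "b \<in> verts G" "a \<noteq> b"
      "F (Inr {(i, a), y}) = gap_color k l i (d a b)"
  | (down) j b where "i = Suc j" "y = (j, b)" "b \<in> verts G" "b \<noteq> a"
      "F (Inr {(i, a), y}) = gap_color k l j (d b a)"
  using assms by (cases y) (auto simp: adj_P layer_coloring_simps)

lemma proper_F: "proper_total_coloring P F"
proof (rule proper_total_coloringI[OF simple_P])
  fix u v assume uv: "adj P u v"
  obtain i a where u: "u = (i, a)"
    by (cases u)
  obtain j b where v: "v = (j, b)"
    by (cases v)
  have V: "a \<in> verts G" "b \<in> verts G"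
    using uv by (auto simp: u v adj_P)
  show "F (Inl u) \<noteq> F (Inl v)"
    using uv V mod_3_neq(1)[of i] mod_3_neq(1)[of j] proper_total_coloringD(1)[OF simple proper]
    by (auto simp: u v adj_P layer_coloring_simps copy_color_eq_iff f_vertex_less)
  from uv[unfolded u] show "F (Inl u) \<noteq> F (Inr {u, v})"
    by (cases rule: adj_P_cases)
      (use V in \<open>auto simp: u layer_coloring_simps(1) copy_color_eq_iff f_vertex_less f_edge_less
          copy_color_neq_gap_color proper_total_coloringD(2)[OF simple proper]\<close>)
next
  fix u v w assume uvw: "adj P u v" "adj P u w" "v \<noteq> w"
  obtain i a where u: "u = (i, a)"
    by (cases u)
  have a: "a \<in> verts G"
    using uvw(1) by (cases v) (auto simp: u adj_P)
  note neq = copy_color_neq_gap_color copy_color_neq_gap_color[symmetric]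
    gap_color_neq_Suc gap_color_neq_Suc[symmetric]
  \<comment> \<open>Edges of different kinds at \<open>u\<close> have disjoint palettes. Two edges
    of the same kind are separated by \<open>f\<close> inside a copy and by injectivity of
    \<open>d\<close> in one argument in a gap.\<close>
  from uvw(1)[unfolded u] show "F (Inr {u, v}) \<noteq> F (Inr {u, w})"
  proof (cases rule: adj_P_cases)
    case (copy b)
    from uvw(2)[unfolded u] show ?thesis
      by (cases rule: adj_P_cases)
        (use copy uvw(3) in \<open>auto simp: u f_edge_less neq copy_color_eq_iff
            dest: proper_total_coloringD(3)[OF simple proper]\<close>)
  next
    case (up b)
    from uvw(2)[unfolded u] show ?thesis
      by (cases rule: adj_P_cases)
        (use up a uvw(3) in \<open>auto simp: u f_edge_less neq d_less
            dest!: gap_color_inject dest: d_inject_right\<close>)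
  next
    case (down j b)
    from uvw(2)[unfolded u] show ?thesis
      by (cases rule: adj_P_cases)
        (use down a uvw(3) in \<open>auto simp: u f_edge_less neq d_less
            dest!: gap_color_inject dest: d_inject_left\<close>)
  qed
qed

lemma F_range: "F ` (verts P <+> edges P) \<subseteq> {..<3 * k + 2 * l}"
proof -
  have "F (Inl v) < 3 * k + 2 * l" if "v \<in> verts P" for v
    using that copy_color_less[OF f_vertex_less]
    by (cases v) (auto simp: deleted_lex_product_def layer_coloring_simps intro: trans_less_add1)
  moreover have "F (Inr e) < 3 * k + 2 * l" if e: "e \<in> edges P" for e
  proof -
    have "e \<noteq> {}"
      using e simple_P by (force simp: simple_graph_def)
    then obtain i a where "(i, a) \<in> e"
      by auto
    with e obtain y where y: "e = {(i, a), y}" "adj P (i, a) y"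
      using simple_graph_edgeE[OF simple_P] by metis
    then have a: "a \<in> verts G"
      by (cases y) (auto simp: adj_P)
    from y(2) show ?thesis
    proof (cases rule: adj_P_cases)
      case (copy b)
      then show ?thesis
        using copy_color_less[OF f_edge_less, of a b i] y by simp
    qed (use y a in \<open>auto simp: gap_color_less d_less\<close>)
  qed
  ultimately show ?thesis
    by auto
qed

section \<open>Distinguishing adjacent vertices\<close>

text \<open>No gap at copy \<open>i\<close> uses the block of copy \<open>i\<close>, so a color that
  \<open>f\<close> misses at \<open>a\<close> stays missing in this block.\<close>

lemma own_block_missing:
  assumes "a \<in> verts G"
  shows "\<exists>c < k. copy_color k i c \<notin> color_set P F (i, a)"
proof -
  obtain c where c: "c < k" "c \<notin> color_set G f a"
    using color_set_misses[OF simple assms] unfolding k by blast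
  have "copy_color k i c \<noteq> F (Inr {(i, a), y})" if "adj P (i, a) y" for y
    using that
    by (cases rule: adj_P_cases)
      (use c in \<open>auto simp: copy_color_eq_iff f_edge_less copy_color_neq_gap_color color_set_def\<close>)
  moreover have "copy_color k i c \<noteq> F (Inl (i, a))"
    using c assms by (auto simp: layer_coloring_simps copy_color_eq_iff f_vertex_less color_set_def)
  ultimately show ?thesis
    using c(1) by (auto simp: color_set_def)
qed

lemma gap_seen_up:
  assumes "a \<in> verts G" "Suc i < n" "c < k + l"
  shows "gap_color k l i c \<in> color_set P F (i, a)"
proof -
  obtain b where b: "b \<in> verts G" "a \<noteq> b" "d a b = c"
    using d_surj_right assms by blast
  then have "adj P (i, a) (Suc i, b)"
    using assms by (simp add: adj_P)
  moreover have "gap_color k l i c = F (Inr {(i, a), (Suc i, b)})"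
    using b by (simp add: layer_coloring_simps)
  ultimately show ?thesis
    by (auto simp: color_set_def)
qed

lemma gap_seen_down:
  assumes "a \<in> verts G" "Suc i < n" "c < k + l"
  shows "gap_color k l i c \<in> color_set P F (Suc i, a)"
proof -
  obtain b where b: "b \<in> verts G" "b \<noteq> a" "d b a = c"
    using d_surj_left assms by blast
  then have "adj P (Suc i, a) (i, b)"
    using assms by (simp add: adj_P)
  moreover have "gap_color k l i c = F (Inr {(Suc i, a), (i, b)})"
    using b by (simp add: layer_coloring_simps)
  ultimately show ?thesis
    by (auto simp: color_set_def)
qed

lemma color_set_neq_up:
  assumes V: "a \<in> verts G" "b \<in> verts G" and i: "Suc i < n"
  shows "color_set P F (i, a) \<noteq> color_set P F (Suc i, b)"
proof (cases "Suc (Suc i) < n")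
  case True
  obtain c where c: "c < k" "copy_color k i c \<notin> color_set P F (i, a)"
    using own_block_missing V by blast
  \<comment> \<open>The upper vertex has a further copy above it, and the gap in between shows it
    the whole block of copy \<open>i\<close>.\<close>
  have "copy_color k i c \<in> color_set P F (Suc i, b)"
    using gap_seen_up[OF V(2) True, of c] c(1) by (simp add: gap_color_Suc_eq_copy_color)
  with c(2) show ?thesis
    by blast
next
  case False
  \<comment> \<open>Here \<open>i + 1\<close> is the last copy, and \<open>n \<ge> 3\<close>
    provides a copy \<open>j\<close> below copy \<open>i\<close>.\<close>
  then obtain j where j: "i = Suc j"
    using n i by (cases i) auto
  obtain c where c: "c < k" "copy_color k (Suc i) c \<notin> color_set P F (Suc i, b)"
    using own_block_missing V by blast
  \<comment> \<open>As \<open>j + 2 = Suc i\<close>, the gap below copy \<open>i\<close> shows the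
    block of copy \<open>i + 1\<close>.\<close>
  have "copy_color k (Suc i) c \<in> color_set P F (i, a)"
    using gap_seen_down[OF V(1), of j c] c(1) i by (simp add: j gap_color_def)
  with c(2) show ?thesis
    by blast
qed

text \<open>Within its own block a vertex sees exactly the colors given by \<open>f\<close>, so
  \<open>f\<close> distinguishes adjacent vertices of the same copy.\<close>

lemma color_set_copy:
  assumes "i < n" "a \<in> verts G"
  shows "{c. c < k \<and> copy_color k i c \<in> color_set P F (i, a)} = color_set G f a"
proof (intro equalityI subsetI)
  fix c assume "c \<in> {c. c < k \<and> copy_color k i c \<in> color_set P F (i, a)}"
  then have c: "c < k" "copy_color k i c \<in> color_set P F (i, a)"
    by auto
  from c(2) consider "copy_color k i c = F (Inl (i, a))"
    | y where "adj P (i, a) y" "copy_color k i c = F (Inr {(i, a), y})"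
    by (auto simp: color_set_def)
  then show "c \<in> color_set G f a"
  proof cases
    case 1
    then show ?thesis
      using c assms by (simp add: layer_coloring_simps copy_color_eq_iff f_vertex_less color_set_def)
  next
    case (2 y)
    from 2(1) show ?thesis
      by (cases rule: adj_P_cases)
        (use c 2 in \<open>auto simp: copy_color_eq_iff f_edge_less copy_color_neq_gap_color color_set_def\<close>)
  qed
next
  fix c assume "c \<in> color_set G f a"
  then consider "c = f (Inl a)" | b where "adj G a b" "c = f (Inr {a, b})"
    by (auto simp: color_set_def)
  then show "c \<in> {c. c < k \<and> copy_color k i c \<in> color_set P F (i, a)}"
  proof cases
    case 1
    then show ?thesis
      using assms f_vertex_less by (auto simp: color_set_def layer_coloring_simps)
  next
    case (2 b)
    then have "adj P (i, a) (i, b)"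
      using assms simple_graph_adjD[OF simple] by (simp add: adj_P)
    moreover have "copy_color k i c = F (Inr {(i, a), (i, b)})"
      using 2 by (simp add: layer_coloring_simps)
    ultimately show ?thesis
      using 2 f_edge_less by (auto simp: color_set_def)
  qed
qed

lemma avd_total_colorable_P: "avd_total_colorable P (3 * k + 2 * l)"
proof -
  have "color_set P F u \<noteq> color_set P F v" if uv: "adj P u v" for u v
  proof -
    obtain i a where u: "u = (i, a)"
      by (cases u)
    obtain j b where v: "v = (j, b)"
      by (cases v)
    have V: "a \<in> verts G" "b \<in> verts G" "i < n" "j < n"
      using uv by (auto simp: u v adj_P)
    consider "i = j" "adj G a b" | "j = Suc i" | "i = Suc j"
      using uv by (auto simp: u v adj_P)
    then show ?thesis
    proof cases
      case 1
      then have "color_set G f a \<noteq> color_set G f b"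
        using avd by (simp add: avd_total_coloring_def)
      then show ?thesis
        using color_set_copy V 1 by (metis u v)
    qed (use color_set_neq_up V u v in metis)+
  qed
  then show ?thesis
    using proper_F F_range unfolding avd_total_colorable_def avd_total_coloring_def by blast
qed

end

theorem theorem3p6:
  fixes G :: "'a graph" and m n :: nat
  assumes "simple_graph G"
    and "card (verts G) = m"
    and "m \<ge> max_degree G + 3"
    and "avd_total_chromatic_number G \<le> max_degree G + 2"
    and "n \<ge> 3"
  shows "avd_total_chromatic_number (deleted_lex_product (path_graph n) G)
         \<le> max_degree (deleted_lex_product (path_graph n) G) + 2"
proof -
  \<comment> \<open>With \<open>k = max_degree G + 2\<close> this is \<open>m - 1 - k\<close>; the
    lower bound on \<open>m\<close> makes the subtraction exact.\<close>
  define l where "l = m - (max_degree G + 3)"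
  have m: "Suc (max_degree G + 2 + l) = m"
    using assms(3) by (simp add: l_def)
  obtain f where f: "avd_total_coloring G f" "f ` (verts G <+> edges G) \<subseteq> {..<max_degree G + 2}"
    using avd_total_colorable_max_degree_add_2[OF assms(1,4)] by (auto simp: avd_total_colorable_def)
  obtain r where "bij_betw r (verts G) {..<m}"
    using ex_bij_betw_finite_nat assms(1,2) by (metis simple_graph_def atLeast0LessThan)
  then interpret layered G r "max_degree G + 2" l n f
    using assms(1,5) f by unfold_locales (simp_all only: m)
  have "verts G \<noteq> {}"
    using assms(2,3) by auto
  then have "max_degree G + 2 * (m - 1) \<le> max_degree P"
    using max_degree_path_product_ge assms(1,2,5) by blast
  \<comment> \<open>The count is \<open>k + 2 * (k + l)\<close>, where
    \<open>k + l = m - 1\<close>.\<close>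
  moreover have "3 * (max_degree G + 2) + 2 * l = max_degree G + 2 * (m - 1) + 2"
    using m by simp
  moreover have "avd_total_chromatic_number P \<le> 3 * (max_degree G + 2) + 2 * l"
    unfolding avd_total_chromatic_number_def using avd_total_colorable_P by (rule Least_le)
  ultimately show ?thesis
    by simp
qed

end
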